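(* Let $k$ be a field, $G$ a finite group, and let $W=\bigoplus_{g\in G}W_g$ be a $G$-graded twisted $k$-algebra (not necessarily associative or commutative). Let $B$ and $B'$ be homogeneous bases for $W$, with associated structure constants $C$ and $C'$, and let $r$ and $r'$ be the corresponding associativity functions, $r(a,b,c)=C(b,c)C(ab,c)^{-1}C(a,bc)C(a,b)^{-1}$ and $r'(a,b,c)=C'(b,c)C'(ab,c)^{-1}C'(a,bc)C'(a,b)^{-1}$. Then $r=r'$; that is, the associativity function of $W$ does not depend on the chosen basis.
   Context: A $G$-graded twisted $k$-algebra is a $k$-algebra $W$ (not necessarily commutative or associative) with a grading $W=\bigoplus_{g\in G}W_g$, $W_aW_b\subset W_{ab}$, such that each $W_g$ is one-dimensional over $k$, $w_aw_b\neq 0$ for all nonzero $w_a\in W_a$, $w_b\in W_b$, and $W$ has an identity element $1\in W_e$, where $e$ is the identity of $G$. A homogeneous basis is $B=\{w_g:g\in G\}$ with $w_g\in W_g$ and $w_e=1$; its structure constant is the function $C:G\times G\to k^*$ with $w_aw_b=C(a,b)w_{ab}$. *)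

theory Defs
  imports "HOL-Algebra.Module"
begin

text \<open>
  The record type of \<open>module\<close> already carries a multiplication and a unit, about which the locale
  \<open>module\<close> assumes nothing. Here they are used for the product of a \<open>K\<close>-algebra that need be neither
  associative nor commutative.
\<close>

locale nonassoc_algebra = K: field K + W: module K W
  for K :: "('k, 'x) ring_scheme" and W :: "('k, 'w, 'y) module_scheme" +
  assumes mult_closed:
      "\<lbrakk>x \<in> carrier W; y \<in> carrier W\<rbrakk> \<Longrightarrow> x \<otimes>\<^bsub>W\<^esub> y \<in> carrier W"
    and mult_add_left:
      "\<lbrakk>x \<in> carrier W; y \<in> carrier W; z \<in> carrier W\<rbrakk> \<Longrightarrow>
        (x \<oplus>\<^bsub>W\<^esub> y) \<otimes>\<^bsub>W\<^esub> z = x \<otimes>\<^bsub>W\<^esub> z \<oplus>\<^bsub>W\<^esub> y \<otimes>\<^bsub>W\<^esub> z"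
    and mult_add_right:
      "\<lbrakk>x \<in> carrier W; y \<in> carrier W; z \<in> carrier W\<rbrakk> \<Longrightarrow>
        z \<otimes>\<^bsub>W\<^esub> (x \<oplus>\<^bsub>W\<^esub> y) = z \<otimes>\<^bsub>W\<^esub> x \<oplus>\<^bsub>W\<^esub> z \<otimes>\<^bsub>W\<^esub> y"
    and mult_smult_left:
      "\<lbrakk>s \<in> carrier K; x \<in> carrier W; y \<in> carrier W\<rbrakk> \<Longrightarrow>
        (s \<odot>\<^bsub>W\<^esub> x) \<otimes>\<^bsub>W\<^esub> y = s \<odot>\<^bsub>W\<^esub> (x \<otimes>\<^bsub>W\<^esub> y)"
    and mult_smult_right:
      "\<lbrakk>s \<in> carrier K; x \<in> carrier W; y \<in> carrier W\<rbrakk> \<Longrightarrow>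
        x \<otimes>\<^bsub>W\<^esub> (s \<odot>\<^bsub>W\<^esub> y) = s \<odot>\<^bsub>W\<^esub> (x \<otimes>\<^bsub>W\<^esub> y)"

text \<open>
  Since \<open>finsum\<close> over an infinite index set is zero by convention, sums over an arbitrary index set
  are restricted to the support, which is required to be finite. The extensional function space
  makes the family of components (or of coefficients) literally unique.
\<close>

definition is_direct_sum ::
  "('k, 'w, 'y) module_scheme \<Rightarrow> 'i set \<Rightarrow> ('i \<Rightarrow> 'w set) \<Rightarrow> bool" where
  "is_direct_sum W I V \<longleftrightarrow>
     (\<forall>x\<in>carrier W. \<exists>!f. f \<in> (\<Pi>\<^sub>E i\<in>I. V i) \<and> finite {i \<in> I. f i \<noteq> \<zero>\<^bsub>W\<^esub>} \<and>
        x = (\<Oplus>\<^bsub>W\<^esub>i\<in>{i \<in> I. f i \<noteq> \<zero>\<^bsub>W\<^esub>}. f i))"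

definition is_basis ::
  "('k, 'x) ring_scheme \<Rightarrow> ('k, 'w, 'y) module_scheme \<Rightarrow> 'i set \<Rightarrow> ('i \<Rightarrow> 'w) \<Rightarrow> bool" where
  "is_basis K W I w \<longleftrightarrow> w \<in> I \<rightarrow> carrier W \<and>
     (\<forall>x\<in>carrier W. \<exists>!s. s \<in> I \<rightarrow>\<^sub>E carrier K \<and> finite {i \<in> I. s i \<noteq> \<zero>\<^bsub>K\<^esub>} \<and>
        x = (\<Oplus>\<^bsub>W\<^esub>i\<in>{i \<in> I. s i \<noteq> \<zero>\<^bsub>K\<^esub>}. s i \<odot>\<^bsub>W\<^esub> w i))"

text \<open>A subspace is one-dimensional if it has a basis consisting of a single vector.\<close>

definition one_dimensional ::
  "('k, 'x) ring_scheme \<Rightarrow> ('k, 'w, 'y) module_scheme \<Rightarrow> 'w set \<Rightarrow> bool" where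
  "one_dimensional K W V \<longleftrightarrow>
     (\<exists>v\<in>V. V = {s \<odot>\<^bsub>W\<^esub> v | s. s \<in> carrier K} \<and>
        (\<forall>s\<in>carrier K. s \<odot>\<^bsub>W\<^esub> v = \<zero>\<^bsub>W\<^esub> \<longrightarrow> s = \<zero>\<^bsub>K\<^esub>))"

locale graded_twisted_algebra = G: group G + nonassoc_algebra K W
  for G :: "('g, 'z) monoid_scheme"
    and K :: "('k, 'x) ring_scheme"
    and W :: "('k, 'w, 'y) module_scheme"
    and Wg :: "'g \<Rightarrow> 'w set" +
  assumes comp_submodule: "g \<in> carrier G \<Longrightarrow> submodule (Wg g) K W"
    and comp_direct_sum: "is_direct_sum W (carrier G) Wg"
    and comp_mult:
      "\<lbrakk>a \<in> carrier G; b \<in> carrier G; x \<in> Wg a; y \<in> Wg b\<rbrakk> \<Longrightarrow>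
        x \<otimes>\<^bsub>W\<^esub> y \<in> Wg (a \<otimes>\<^bsub>G\<^esub> b)"
    and comp_one_dimensional: "g \<in> carrier G \<Longrightarrow> one_dimensional K W (Wg g)"
    and comp_mult_nonzero:
      "\<lbrakk>a \<in> carrier G; b \<in> carrier G; x \<in> Wg a; y \<in> Wg b; x \<noteq> \<zero>\<^bsub>W\<^esub>; y \<noteq> \<zero>\<^bsub>W\<^esub>\<rbrakk> \<Longrightarrow>
        x \<otimes>\<^bsub>W\<^esub> y \<noteq> \<zero>\<^bsub>W\<^esub>"
    and one_in_comp: "\<one>\<^bsub>W\<^esub> \<in> Wg \<one>\<^bsub>G\<^esub>"
    and mult_one_left: "x \<in> carrier W \<Longrightarrow> \<one>\<^bsub>W\<^esub> \<otimes>\<^bsub>W\<^esub> x = x"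
    and mult_one_right: "x \<in> carrier W \<Longrightarrow> x \<otimes>\<^bsub>W\<^esub> \<one>\<^bsub>W\<^esub> = x"

definition homogeneous_basis ::
  "('g, 'z) monoid_scheme \<Rightarrow> ('k, 'x) ring_scheme \<Rightarrow> ('k, 'w, 'y) module_scheme \<Rightarrow>
    ('g \<Rightarrow> 'w set) \<Rightarrow> ('g \<Rightarrow> 'w) \<Rightarrow> bool" where
  "homogeneous_basis G K W Wg w \<longleftrightarrow>
     is_basis K W (carrier G) w \<and> (\<forall>g\<in>carrier G. w g \<in> Wg g) \<and> w \<one>\<^bsub>G\<^esub> = \<one>\<^bsub>W\<^esub>"

definition structure_constant ::
  "('g, 'z) monoid_scheme \<Rightarrow> ('k, 'x) ring_scheme \<Rightarrow> ('k, 'w, 'y) module_scheme \<Rightarrow>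
    ('g \<Rightarrow> 'w) \<Rightarrow> ('g \<times> 'g \<Rightarrow> 'k) \<Rightarrow> bool" where
  "structure_constant G K W w C \<longleftrightarrow>
     C \<in> carrier G \<times> carrier G \<rightarrow> Units K \<and>
     (\<forall>a\<in>carrier G. \<forall>b\<in>carrier G. w a \<otimes>\<^bsub>W\<^esub> w b = C (a, b) \<odot>\<^bsub>W\<^esub> w (a \<otimes>\<^bsub>G\<^esub> b))"

text \<open>Restricted to the carrier, so that equality of associativity functions is plain equality.\<close>

definition associativity_function ::
  "('g, 'z) monoid_scheme \<Rightarrow> ('k, 'x) ring_scheme \<Rightarrow> ('g \<times> 'g \<Rightarrow> 'k) \<Rightarrow>
    'g \<times> 'g \<times> 'g \<Rightarrow> 'k" where
  "associativity_function G K C =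
     (\<lambda>(a, b, c)\<in>carrier G \<times> carrier G \<times> carrier G.
        C (b, c) \<otimes>\<^bsub>K\<^esub> inv\<^bsub>K\<^esub> C (a \<otimes>\<^bsub>G\<^esub> b, c) \<otimes>\<^bsub>K\<^esub> C (a, b \<otimes>\<^bsub>G\<^esub> c) \<otimes>\<^bsub>K\<^esub> inv\<^bsub>K\<^esub> C (a, b))"

end

theory Submission
  imports Defs
begin

text \<open>
  The associativity function is characterised without reference to a basis: all homogeneous
  \<open>x\<close>, \<open>y\<close>, \<open>z\<close> of degrees \<open>a\<close>, \<open>b\<close>, \<open>c\<close> satisfy \<open>x (y z) = r(a,b,c) (x y) z\<close>. This holds for basis
  vectors by the formula for \<open>r\<close>, and both sides are trilinear on one-dimensional spaces. Since
  \<open>(x y) z \<noteq> 0\<close> for nonzero homogeneous elements, the scalar is determined by \<open>W\<close>.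
\<close>

lemma (in nonassoc_algebra) smult_eq_zeroD:
  assumes "s \<in> carrier K" "x \<in> carrier W" "s \<odot>\<^bsub>W\<^esub> x = \<zero>\<^bsub>W\<^esub>" "x \<noteq> \<zero>\<^bsub>W\<^esub>"
  shows "s = \<zero>\<^bsub>K\<^esub>"
proof (rule ccontr)
  assume "s \<noteq> \<zero>\<^bsub>K\<^esub>"
  with assms(1) have s: "s \<in> Units K" by (simp add: K.field_Units)
  have "x = (inv\<^bsub>K\<^esub> s \<otimes>\<^bsub>K\<^esub> s) \<odot>\<^bsub>W\<^esub> x"
    using s assms(2) by simp
  also have "\<dots> = inv\<^bsub>K\<^esub> s \<odot>\<^bsub>W\<^esub> (s \<odot>\<^bsub>W\<^esub> x)"
    using s assms(1,2) by (intro W.smult_assoc1) auto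
  also have "\<dots> = \<zero>\<^bsub>W\<^esub>" using s assms(3) by simp
  finally show False using assms(4) by simp
qed

text \<open>The difference of the two scalars annihilates a nonzero vector, so it vanishes. This is
  how the associativity scalar is recovered from its action on a nonzero triple product.\<close>

lemma (in nonassoc_algebra) smult_right_cancel:
  assumes "s \<in> carrier K" "t \<in> carrier K" "x \<in> carrier W"
    and "s \<odot>\<^bsub>W\<^esub> x = t \<odot>\<^bsub>W\<^esub> x" "x \<noteq> \<zero>\<^bsub>W\<^esub>"
  shows "s = t"
proof -
  have "(s \<ominus>\<^bsub>K\<^esub> t) \<odot>\<^bsub>W\<^esub> x = \<zero>\<^bsub>W\<^esub>"
    using assms(1-4)
    by (simp add: a_minus_def W.smult_l_distr W.smult_l_minus W.r_neg)
  then have "s \<ominus>\<^bsub>K\<^esub> t = \<zero>\<^bsub>K\<^esub>"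
    using assms by (intro smult_eq_zeroD[of _ x]) auto
  then show ?thesis
    using assms(1,2) K.minus_equality[of s "\<ominus>\<^bsub>K\<^esub> t"] by (simp add: a_minus_def)
qed

text \<open>A zero basis vector would give the zero vector two different expansions, against
  uniqueness of coefficients.\<close>

lemma (in nonassoc_algebra) basis_nonzero:
  assumes "is_basis K W I w" "i \<in> I"
  shows "w i \<noteq> \<zero>\<^bsub>W\<^esub>"
proof
  assume wi: "w i = \<zero>\<^bsub>W\<^esub>"
  define P where "P s \<longleftrightarrow> s \<in> I \<rightarrow>\<^sub>E carrier K \<and> finite {j \<in> I. s j \<noteq> \<zero>\<^bsub>K\<^esub>} \<and>
    \<zero>\<^bsub>W\<^esub> = (\<Oplus>\<^bsub>W\<^esub>j\<in>{j \<in> I. s j \<noteq> \<zero>\<^bsub>K\<^esub>}. s j \<odot>\<^bsub>W\<^esub> w j)" for s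
  \<comment> \<open>The two competing coefficient families: the zero family, with empty support, and
    the indicator of \<open>i\<close>, whose only term is \<open>w i\<close>. Both are restricted to
    \<open>I\<close>, since \<open>P\<close> asks for extensional functions.\<close>
  let ?s = "\<lambda>j\<in>I. \<zero>\<^bsub>K\<^esub>" and ?t = "\<lambda>j\<in>I. if j = i then \<one>\<^bsub>K\<^esub> else \<zero>\<^bsub>K\<^esub>"
  have "\<exists>!s. P s"
    using assms(1) W.zero_closed unfolding is_basis_def P_def by blast
  moreover have "P ?s"
  proof -
    have "{j \<in> I. ?s j \<noteq> \<zero>\<^bsub>K\<^esub>} = {}" by auto
    then show ?thesis unfolding P_def by (simp del: restrict_apply) auto
  qed
  moreover have "P ?t"
  proof -
    have "{j \<in> I. ?t j \<noteq> \<zero>\<^bsub>K\<^esub>} = {i}" using assms(2) by auto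
    then show ?thesis unfolding P_def using assms(2) wi
      by (simp add: Pi_def)
  qed
  ultimately have "?s i = ?t i" by metis
  then show False using assms(2) by simp
qed

context graded_twisted_algebra
begin

lemma comp_carrier: "g \<in> carrier G \<Longrightarrow> x \<in> Wg g \<Longrightarrow> x \<in> carrier W"
  using comp_submodule W.submoduleE(1) by blast

text \<open>Any nonzero element spans its component: if \<open>x\<close> is \<open>p\<close> times
  and \<open>y\<close> is \<open>q\<close> times a generator, then \<open>q\<close> is invertible
  and \<open>x\<close> is p/q times \<open>y\<close>. It is applied with \<open>y\<close> a basis
  vector.\<close>

lemma comp_eq_smult:
  assumes "g \<in> carrier G" "x \<in> Wg g" "y \<in> Wg g" "y \<noteq> \<zero>\<^bsub>W\<^esub>"
  obtains s where "s \<in> carrier K" "x = s \<odot>\<^bsub>W\<^esub> y"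
proof -
  obtain v where v: "v \<in> Wg g" "Wg g = {s \<odot>\<^bsub>W\<^esub> v | s. s \<in> carrier K}"
    using comp_one_dimensional[OF assms(1)] unfolding one_dimensional_def by blast
  have vW: "v \<in> carrier W" using comp_carrier assms(1) v(1) .
  obtain p where p: "p \<in> carrier K" "x = p \<odot>\<^bsub>W\<^esub> v" using v(2) assms(2) by blast
  obtain q where q: "q \<in> carrier K" "y = q \<odot>\<^bsub>W\<^esub> v" using v(2) assms(3) by blast
  have "q \<noteq> \<zero>\<^bsub>K\<^esub>" using q assms(4) vW by auto
  then have qU: "q \<in> Units K" using q(1) by (simp add: K.field_Units)
  show thesis
  proof
    show "p \<otimes>\<^bsub>K\<^esub> inv\<^bsub>K\<^esub> q \<in> carrier K" using p(1) qU by simp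
    show "x = (p \<otimes>\<^bsub>K\<^esub> inv\<^bsub>K\<^esub> q) \<odot>\<^bsub>W\<^esub> y"
      using p q(1) qU vW by (simp add: q(2) W.smult_assoc1[symmetric] K.m_assoc)
  qed
qed

text \<open>Both bracketings are multiples of the same basis vector of degree abc, with coefficients
  C(b,c) C(a,bc) and C(a,b) C(ab,c). The associativity function is the quotient of the first by the
  second.\<close>

lemma basis_reassociate:
  assumes w: "homogeneous_basis G K W Wg w" and C: "structure_constant G K W w C"
    and abc: "a \<in> carrier G" "b \<in> carrier G" "c \<in> carrier G"
  shows "w a \<otimes>\<^bsub>W\<^esub> (w b \<otimes>\<^bsub>W\<^esub> w c) =
    associativity_function G K C (a, b, c) \<odot>\<^bsub>W\<^esub> ((w a \<otimes>\<^bsub>W\<^esub> w b) \<otimes>\<^bsub>W\<^esub> w c)"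
proof -
  have wW: "w g \<in> carrier W" if "g \<in> carrier G" for g
    using w that comp_carrier unfolding homogeneous_basis_def by blast
  have CU: "C (g, h) \<in> Units K" if "g \<in> carrier G" "h \<in> carrier G" for g h
    using C that unfolding structure_constant_def by blast
  have CK: "C (g, h) \<in> carrier K" if "g \<in> carrier G" "h \<in> carrier G" for g h
    using CU[OF that] by (rule K.Units_closed)
  have mult: "w g \<otimes>\<^bsub>W\<^esub> w h = C (g, h) \<odot>\<^bsub>W\<^esub> w (g \<otimes>\<^bsub>G\<^esub> h)"
    if "g \<in> carrier G" "h \<in> carrier G" for g h
    using C that unfolding structure_constant_def by blast
  let ?p = "C (b, c)" and ?q = "C (a \<otimes>\<^bsub>G\<^esub> b, c)"
    and ?s = "C (a, b \<otimes>\<^bsub>G\<^esub> c)" and ?t = "C (a, b)"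
  let ?v = "w (a \<otimes>\<^bsub>G\<^esub> b \<otimes>\<^bsub>G\<^esub> c)"
  have U: "?p \<in> Units K" "?q \<in> Units K" "?s \<in> Units K" "?t \<in> Units K"
    using CU abc by auto
  have c: "?p \<in> carrier K" "?q \<in> carrier K" "?s \<in> carrier K" "?t \<in> carrier K"
    "inv\<^bsub>K\<^esub> ?q \<in> carrier K" "inv\<^bsub>K\<^esub> ?t \<in> carrier K"
    using U by auto
  have vW: "?v \<in> carrier W" using wW abc by simp
  have left: "w a \<otimes>\<^bsub>W\<^esub> (w b \<otimes>\<^bsub>W\<^esub> w c) = (?p \<otimes>\<^bsub>K\<^esub> ?s) \<odot>\<^bsub>W\<^esub> ?v"
    using abc c vW by (simp add: mult mult_smult_right wW G.m_assoc W.smult_assoc1)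
  have right: "(w a \<otimes>\<^bsub>W\<^esub> w b) \<otimes>\<^bsub>W\<^esub> w c = (?t \<otimes>\<^bsub>K\<^esub> ?q) \<odot>\<^bsub>W\<^esub> ?v"
    using abc c vW by (simp add: mult mult_smult_left wW W.smult_assoc1)
  \<comment> \<open>Pure reordering in the commutative field, placing each inverse next to its
    partner; the cancellation laws are held back until the next step.\<close>
  have "?p \<otimes>\<^bsub>K\<^esub> inv\<^bsub>K\<^esub> ?q \<otimes>\<^bsub>K\<^esub> ?s \<otimes>\<^bsub>K\<^esub> inv\<^bsub>K\<^esub> ?t \<otimes>\<^bsub>K\<^esub> (?t \<otimes>\<^bsub>K\<^esub> ?q) =
      (?p \<otimes>\<^bsub>K\<^esub> ?s) \<otimes>\<^bsub>K\<^esub> ((inv\<^bsub>K\<^esub> ?t \<otimes>\<^bsub>K\<^esub> ?t) \<otimes>\<^bsub>K\<^esub> (inv\<^bsub>K\<^esub> ?q \<otimes>\<^bsub>K\<^esub> ?q))"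
    using c by (simp add: K.m_ac del: K.Units_l_inv K.Units_r_inv)
  also have "\<dots> = ?p \<otimes>\<^bsub>K\<^esub> ?s" using U c by simp
  finally have "associativity_function G K C (a, b, c) \<otimes>\<^bsub>K\<^esub> (?t \<otimes>\<^bsub>K\<^esub> ?q) = ?p \<otimes>\<^bsub>K\<^esub> ?s"
    using abc by (simp add: associativity_function_def)
  moreover have "associativity_function G K C (a, b, c) \<in> carrier K"
    using abc c by (simp add: associativity_function_def)
  ultimately show ?thesis
    unfolding left right using c vW by (metis W.smult_assoc1 K.m_closed)
qed

lemma associativity_function_closed:
  assumes "structure_constant G K W w C"
    and "a \<in> carrier G" "b \<in> carrier G" "c \<in> carrier G"
  shows "associativity_function G K C (a, b, c) \<in> carrier K"
proof -
  have "C (g, h) \<in> Units K" if "g \<in> carrier G" "h \<in> carrier G" for g h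
    using assms(1) that unfolding structure_constant_def by blast
  then show ?thesis using assms(2-) by (simp add: associativity_function_def K.Units_closed)
qed

lemma homogeneous_reassociate:
  assumes w: "homogeneous_basis G K W Wg w" and C: "structure_constant G K W w C"
    and abc: "a \<in> carrier G" "b \<in> carrier G" "c \<in> carrier G"
    and xyz: "x \<in> Wg a" "y \<in> Wg b" "z \<in> Wg c"
  shows "x \<otimes>\<^bsub>W\<^esub> (y \<otimes>\<^bsub>W\<^esub> z) =
    associativity_function G K C (a, b, c) \<odot>\<^bsub>W\<^esub> ((x \<otimes>\<^bsub>W\<^esub> y) \<otimes>\<^bsub>W\<^esub> z)"
proof -
  have wg: "w g \<in> Wg g" if "g \<in> carrier G" for g
    using w that unfolding homogeneous_basis_def by blast
  have w0: "w g \<noteq> \<zero>\<^bsub>W\<^esub>" if "g \<in> carrier G" for g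
    using w basis_nonzero[OF _ that] unfolding homogeneous_basis_def by simp
  have wW: "w g \<in> carrier W" if "g \<in> carrier G" for g
    using comp_carrier that wg[OF that] .
  obtain p where p: "p \<in> carrier K" "x = p \<odot>\<^bsub>W\<^esub> w a"
    using comp_eq_smult[OF abc(1) xyz(1) wg w0] abc by blast
  obtain q where q: "q \<in> carrier K" "y = q \<odot>\<^bsub>W\<^esub> w b"
    using comp_eq_smult[OF abc(2) xyz(2) wg w0] abc by blast
  obtain s where s: "s \<in> carrier K" "z = s \<odot>\<^bsub>W\<^esub> w c"
    using comp_eq_smult[OF abc(3) xyz(3) wg w0] abc by blast
  let ?r = "associativity_function G K C (a, b, c)"
  have r: "?r \<in> carrier K" using associativity_function_closed[OF C abc] .
  let ?m = "(w a \<otimes>\<^bsub>W\<^esub> w b) \<otimes>\<^bsub>W\<^esub> w c"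
  have m: "?m \<in> carrier W" using wW abc by (simp add: mult_closed)
  \<comment> \<open>Either bracketing of \<open>x\<close>, \<open>y\<close>, \<open>z\<close> yields
    the same factor pqs, so the identity for basis vectors only has to be scaled by it.\<close>
  have "x \<otimes>\<^bsub>W\<^esub> (y \<otimes>\<^bsub>W\<^esub> z) = (p \<otimes>\<^bsub>K\<^esub> (q \<otimes>\<^bsub>K\<^esub> s)) \<odot>\<^bsub>W\<^esub> (w a \<otimes>\<^bsub>W\<^esub> (w b \<otimes>\<^bsub>W\<^esub> w c))"
    using p q s wW abc
    by (simp add: mult_smult_left mult_smult_right mult_closed W.smult_assoc1[symmetric] K.m_ac)
  also have "\<dots> = (p \<otimes>\<^bsub>K\<^esub> (q \<otimes>\<^bsub>K\<^esub> s)) \<odot>\<^bsub>W\<^esub> (?r \<odot>\<^bsub>W\<^esub> ?m)"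
    by (simp add: basis_reassociate[OF w C abc])
  also have "\<dots> = ?r \<odot>\<^bsub>W\<^esub> ((p \<otimes>\<^bsub>K\<^esub> (q \<otimes>\<^bsub>K\<^esub> s)) \<odot>\<^bsub>W\<^esub> ?m)"
    using r p(1) q(1) s(1) m by (metis W.smult_assoc1 K.m_comm K.m_closed)
  also have "(p \<otimes>\<^bsub>K\<^esub> (q \<otimes>\<^bsub>K\<^esub> s)) \<odot>\<^bsub>W\<^esub> ?m = (x \<otimes>\<^bsub>W\<^esub> y) \<otimes>\<^bsub>W\<^esub> z"
    using p q s wW abc
    by (simp add: mult_smult_left mult_smult_right mult_closed W.smult_assoc1[symmetric] K.m_ac)
  finally show ?thesis .
qed

end

theorem corollary2:
  fixes G :: "('g, 'z) monoid_scheme"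
    and K :: "('k, 'x) ring_scheme"
    and W :: "('k, 'w, 'y) module_scheme"
    and Wg :: "'g \<Rightarrow> 'w set"
    and w w' :: "'g \<Rightarrow> 'w"
    and C C' :: "'g \<times> 'g \<Rightarrow> 'k"
  assumes "field K"
    and "group G" and "finite (carrier G)"
    and "graded_twisted_algebra G K W Wg"
    and "homogeneous_basis G K W Wg w"
    and "homogeneous_basis G K W Wg w'"
    and "structure_constant G K W w C"
    and "structure_constant G K W w' C'"
  shows "associativity_function G K C = associativity_function G K C'"
proof -
  interpret graded_twisted_algebra G K W Wg by fact
  have "associativity_function G K C (a, b, c) = associativity_function G K C' (a, b, c)"
    if abc: "a \<in> carrier G" "b \<in> carrier G" "c \<in> carrier G" for a b c
  proof (rule smult_right_cancel)
    have wg: "w g \<in> Wg g" "w g \<noteq> \<zero>\<^bsub>W\<^esub>" if "g \<in> carrier G" for g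
      using assms(5) that basis_nonzero[OF _ that] unfolding homogeneous_basis_def by simp_all
    let ?m = "(w a \<otimes>\<^bsub>W\<^esub> w b) \<otimes>\<^bsub>W\<^esub> w c"
    have ab: "a \<otimes>\<^bsub>G\<^esub> b \<in> carrier G" using abc by simp
    have wab: "w a \<otimes>\<^bsub>W\<^esub> w b \<in> Wg (a \<otimes>\<^bsub>G\<^esub> b)" "w a \<otimes>\<^bsub>W\<^esub> w b \<noteq> \<zero>\<^bsub>W\<^esub>"
      using comp_mult[OF abc(1,2)] comp_mult_nonzero[OF abc(1,2)] wg abc by simp_all
    \<comment> \<open>The product of the first two vectors is again homogeneous and nonzero, so the
      nonvanishing axiom applies a second time.\<close>
    show "?m \<noteq> \<zero>\<^bsub>W\<^esub>"
      using comp_mult_nonzero[OF ab abc(3)] wab wg abc by simp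
    show "?m \<in> carrier W"
      using abc comp_carrier[OF _ wg(1)] by (simp add: mult_closed)
    \<comment> \<open>Both sides equal \<open>w a\<close> times (\<open>w b\<close> times
      \<open>w c\<close>). For \<open>C'\<close> the reassociation law, derived from
      \<open>w'\<close>, is evaluated at vectors of the other basis \<open>w\<close>, which is
      possible because it holds for all homogeneous elements.\<close>
    show "associativity_function G K C (a, b, c) \<odot>\<^bsub>W\<^esub> ?m =
        associativity_function G K C' (a, b, c) \<odot>\<^bsub>W\<^esub> ?m"
      using homogeneous_reassociate[OF assms(5,7) abc wg(1) wg(1) wg(1)]
        homogeneous_reassociate[OF assms(6,8) abc wg(1) wg(1) wg(1)] abc by simp
  qed (use abc associativity_function_closed assms(7,8) in blast)+
  \<comment> \<open>Outside the triples of group elements both functions are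
    \<open>undefined\<close> by restriction, so pointwise agreement on the carrier suffices.\<close>
  then show ?thesis
    by (auto simp: associativity_function_def fun_eq_iff)
qed

end
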